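(* Let $n\ge 1$, let $A,B\in M_n(\mathbb{C})$ and let $2\le p<\infty$. Then $$\omega_p\left(\begin{bmatrix} 0 & A \\ B & 0 \end{bmatrix}\right)\le 2^{\frac1p}\min\left(\omega_p(A),\omega_p(B)\right)+\min\left(\omega_p(A+B),\omega_p(A-B)\right).$$
   Context: $M_m(\mathbb{C})$ is the space of $m\times m$ complex matrices, $T^*$ the conjugate transpose, $\operatorname{Re}(T)=\frac12(T+T^* )$. For $1\le p<\infty$, $\|T\|_p=(\operatorname{tr}((T^*T)^{p/2}))^{1/p}$ is the Schatten $p$-norm. The Schatten $p$-generalized numerical radius of a square complex matrix $T$ is $\omega_p(T)=\sup_{\theta\in\mathbb{R}}\|\operatorname{Re}(e^{i\theta}T)\|_p$. *)

theory Defs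
  imports Complex_Main "Jordan_Normal_Form.Schur_Decomposition"
begin

definition mat_trace :: "complex mat \<Rightarrow> complex" where
  "mat_trace A = (\<Sum>i<dim_row A. A $$ (i, i))"

definition unitary_mat :: "nat \<Rightarrow> complex mat \<Rightarrow> bool" where
  "unitary_mat n U \<longleftrightarrow> U \<in> carrier_mat n n \<and> mat_adjoint U * U = 1\<^sub>m n"

text \<open>Continuous functional calculus: \<open>P\<close> is the power \<open>H\<^sup>s\<close> of a positive semidefinite \<open>H\<close>
  if some unitary diagonalisation of \<open>H\<close> with nonnegative eigenvalues \<open>d i\<close> diagonalises \<open>P\<close>
  with eigenvalues \<open>(d i)\<^sup>s\<close>.\<close>

definition is_psd_powr :: "complex mat \<Rightarrow> real \<Rightarrow> complex mat \<Rightarrow> bool" where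
  "is_psd_powr H s P \<longleftrightarrow> (\<exists>U (d :: nat \<Rightarrow> real). let n = dim_row H in
     unitary_mat n U \<and> (\<forall>i<n. 0 \<le> d i) \<and>
     H = U * mat_diag n (\<lambda>i. complex_of_real (d i)) * mat_adjoint U \<and>
     P = U * mat_diag n (\<lambda>i. complex_of_real (d i powr s)) * mat_adjoint U)"

text \<open>Such a \<open>P\<close> exists for positive semidefinite \<open>H\<close> by the spectral theorem, and it does not
  depend on the diagonalisation, see \<open>psd_powr_eqI\<close> below.\<close>

definition psd_powr :: "complex mat \<Rightarrow> real \<Rightarrow> complex mat" where
  "psd_powr H s = (THE P. is_psd_powr H s P)"

text \<open>The trace below is that of a positive semidefinite matrix, hence a nonnegative real number;
  \<open>Re\<close> only changes its type.\<close>

definition schatten_norm :: "real \<Rightarrow> complex mat \<Rightarrow> real" where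
  "schatten_norm p T = Re (mat_trace (psd_powr (mat_adjoint T * T) (p / 2))) powr (1 / p)"

definition re_mat :: "complex mat \<Rightarrow> complex mat" where
  "re_mat T = (1 / 2) \<cdot>\<^sub>m (T + mat_adjoint T)"

text \<open>\<open>cis \<theta>\<close> is $e^{i\theta}$. The supremum is over a bounded set of reals, so it is a genuine one.\<close>

definition schatten_num_radius :: "real \<Rightarrow> complex mat \<Rightarrow> real" where
  "schatten_num_radius p T = (SUP \<theta>::real. schatten_norm p (re_mat (cis \<theta> \<cdot>\<^sub>m T)))"

lemma mat_adjoint_carrier: "A \<in> carrier_mat m n \<Longrightarrow> mat_adjoint A \<in> carrier_mat n m"
  unfolding mat_adjoint_def carrier_mat_def by auto

lemma unitary_mat_right:
  assumes "unitary_mat n U"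
  shows "U * mat_adjoint U = 1\<^sub>m n"
  using assms mat_mult_left_right_inverse[of "mat_adjoint U" n U] mat_adjoint_carrier[of U n n]
  unfolding unitary_mat_def by auto

lemma is_psd_powr_unique:
  assumes P: "is_psd_powr H s P" and Q: "is_psd_powr H s Q"
  shows "P = Q"
proof -
  define n where "n = dim_row H"
  define D :: "(nat \<Rightarrow> real) \<Rightarrow> complex mat" where "D f = mat_diag n (\<lambda>i. complex_of_real (f i))" for f
  obtain U d where U: "unitary_mat n U" and d: "\<forall>i<n. 0 \<le> d i"
    and HU: "H = U * D d * mat_adjoint U" and PU: "P = U * D (\<lambda>i. d i powr s) * mat_adjoint U"
    using P unfolding is_psd_powr_def Let_def n_def D_def by blast
  obtain V e where V: "unitary_mat n V" and e: "\<forall>i<n. 0 \<le> e i"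
    and HV: "H = V * D e * mat_adjoint V" and QV: "Q = V * D (\<lambda>i. e i powr s) * mat_adjoint V"
    using Q unfolding is_psd_powr_def Let_def n_def D_def by blast
  define U' V' where "U' = mat_adjoint U" and "V' = mat_adjoint V"
  have c[simp]: "U \<in> carrier_mat n n" "V \<in> carrier_mat n n"
    "U' \<in> carrier_mat n n" "V' \<in> carrier_mat n n" "\<And>f. D f \<in> carrier_mat n n"
    using U V mat_adjoint_carrier unfolding unitary_mat_def U'_def V'_def D_def by auto
  have m[simp]: "\<And>X Y. X \<in> carrier_mat n n \<Longrightarrow> Y \<in> carrier_mat n n \<Longrightarrow> X * Y \<in> carrier_mat n n"
    by simp
  have inv: "U' * U = 1\<^sub>m n" "U * U' = 1\<^sub>m n" "V' * V = 1\<^sub>m n" "V * V' = 1\<^sub>m n"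
    using U V unitary_mat_right unfolding unitary_mat_def U'_def V'_def by auto
  note assoc = assoc_mult_mat[of _ n n _ n _ n] left_mult_one_mat[of _ n n] right_mult_one_mat[of _ n n]
  define W where "W = V' * U"
  have cW[simp]: "W \<in> carrier_mat n n" unfolding W_def by simp
  have canc: "X * (Y * Z) = Z" if "X * Y = 1\<^sub>m n" "X \<in> carrier_mat n n" "Y \<in> carrier_mat n n" "Z \<in> carrier_mat n n"
    for X Y Z :: "complex mat"
    using assoc(1)[of X Y Z] that by simp
  have "U * D d * U' = V * D e * V'" using HU HV unfolding U'_def V'_def by simp
  hence "V' * (U * D d * U') * U = V' * (V * D e * V') * U" by simp
  moreover have "V' * (U * D d * U') * U = W * D d"
    unfolding W_def by (simp add: assoc inv canc)
  moreover have "V' * (V * D e * V') * U = D e * W"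
    unfolding W_def by (simp add: assoc inv canc)
  ultimately have WD: "W * D d = D e * W" by simp
  have "W * D (\<lambda>i. d i powr s) = D (\<lambda>i. e i powr s) * W"
  proof (rule eq_matI)
    fix i j assume "i < dim_row (D (\<lambda>i. e i powr s) * W)" "j < dim_col (D (\<lambda>i. e i powr s) * W)"
    hence ij: "i < n" "j < n" using cW c(5)[of "\<lambda>i. e i powr s"] by (auto simp del: cW c)
    have "W $$ (i,j) * of_real (d j) = of_real (e i) * W $$ (i,j)"
      using arg_cong[OF WD, of "\<lambda>X. X $$ (i,j)"] ij
      unfolding D_def mat_diag_mult_left[OF cW] mat_diag_mult_right[OF cW] by simp
    hence "W $$ (i,j) = 0 \<or> d j = e i" by (simp add: mult.commute)
    thus "(W * D (\<lambda>i. d i powr s)) $$ (i,j) = (D (\<lambda>i. e i powr s) * W) $$ (i,j)"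
      using ij unfolding D_def mat_diag_mult_left[OF cW] mat_diag_mult_right[OF cW] by auto
  qed (use carrier_matD[OF cW] in \<open>auto simp: D_def mat_diag_def\<close>)
  hence "V * (W * D (\<lambda>i. d i powr s)) * U' = V * (D (\<lambda>i. e i powr s) * W) * U'" by simp
  moreover have "V * (W * D (\<lambda>i. d i powr s)) * U' = P"
    unfolding W_def PU U'_def[symmetric] by (simp add: assoc inv canc)
  moreover have "V * (D (\<lambda>i. e i powr s) * W) * U' = Q"
    unfolding W_def QV V'_def[symmetric] by (simp add: assoc inv canc)
  ultimately show ?thesis by simp
qed

lemma psd_powr_eqI: "is_psd_powr H s P \<Longrightarrow> psd_powr H s = P"
  unfolding psd_powr_def using is_psd_powr_unique by (intro the_equality) auto

end

theory Submission
  imports Defs "HOL-Analysis.Convex" "HOL-Analysis.L2_Norm"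
begin

text \<open>Everything rests on a variational formula valid for \<open>p \<ge> 2\<close>: \<open>\<parallel>T\<parallel>\<^sub>p\<close> to the power \<open>p\<close> is the
  maximum of \<open>\<Sum>\<^sub>j \<parallel>T u\<^sub>j\<parallel> powr p\<close> over orthonormal bases \<open>u\<close>, attained at an eigenbasis of
  \<open>T\<^sup>* T\<close>. It yields the triangle inequality, \<open>\<parallel>T\<^sup>*\<parallel>\<^sub>p = \<parallel>T\<parallel>\<^sub>p\<close> and, through McCarthy's and
  Clarkson's inequalities applied to \<open>C = Re C + \<i> Re (- \<i> C)\<close>, the bound
  \<open>2 powr (1 / p) * \<parallel>C\<parallel>\<^sub>p \<le> 2 * \<omega>\<^sub>p C\<close>. The real part of \<open>e\<^sup>i\<^sup>\<theta>\<close> times the block matrix has an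
  off-diagonal corner \<open>X = (e\<^sup>i\<^sup>\<theta> A + e\<^sup>-\<^sup>i\<^sup>\<theta> B\<^sup>*) / 2\<close> and Schatten norm \<open>2 powr (1 / p) * \<parallel>X\<parallel>\<^sub>p\<close>.
  Replacing \<open>B\<close> by \<open>\<plusminus> A\<close> in \<open>X\<close> leaves a unimodular multiple of some \<open>Re (e\<^sup>i\<^sup>\<phi> A)\<close>, at the cost of
  half the Schatten norm of \<open>A \<mp> B\<close>; the roles of \<open>A\<close> and \<open>B\<close> can be exchanged by passing
  to \<open>X\<^sup>*\<close>.\<close>

section \<open>Adjoints and unitary matrices\<close>

lemma dim_mat_adjoint [simp]:
  "dim_row (mat_adjoint A) = dim_col A" "dim_col (mat_adjoint A) = dim_row A"
  by (simp_all add: mat_adjoint_def)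

lemma mat_adjoint_index [simp]:
  fixes A :: "complex mat"
  assumes "i < dim_col A" "j < dim_row A"
  shows "mat_adjoint A $$ (i, j) = cnj (A $$ (j, i))"
  using assms by (simp add: mat_adjoint_def mat_of_rows_index)

lemma mat_adjoint_adjoint [simp]: "mat_adjoint (mat_adjoint A) = (A :: complex mat)"
  by (rule eq_matI) auto

lemma mat_adjoint_mult:
  fixes A B :: "complex mat"
  assumes "A \<in> carrier_mat m n" "B \<in> carrier_mat n k"
  shows "mat_adjoint (A * B) = mat_adjoint B * mat_adjoint A"
  using assms by (intro eq_matI) (auto simp: scalar_prod_def mult.commute)

lemma mat_adjoint_mat_diag: "mat_adjoint (mat_diag n f) = mat_diag n (\<lambda>i. cnj (f i))"
  by (intro eq_matI) (auto simp: mat_diag_def)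

lemma mat_adjoint_four_block:
  fixes A B C D :: "complex mat"
  assumes "A \<in> carrier_mat m1 n1" "B \<in> carrier_mat m1 n2"
    "C \<in> carrier_mat m2 n1" "D \<in> carrier_mat m2 n2"
  shows "mat_adjoint (four_block_mat A B C D)
    = four_block_mat (mat_adjoint A) (mat_adjoint C) (mat_adjoint B) (mat_adjoint D)"
  using assms by (intro eq_matI) auto

lemma mat_adjoint_one [simp]: "mat_adjoint (1\<^sub>m n) = (1\<^sub>m n :: complex mat)"
  by (intro eq_matI) auto

lemma mat_adjoint_zero [simp]: "mat_adjoint (0\<^sub>m m n) = (0\<^sub>m n m :: complex mat)"
  by (intro eq_matI) auto

text \<open>The squared Euclidean norm of a column. It stays squared because it is then a diagonal
  entry of the Gram matrix and, when the columns are orthogonal, an eigenvalue of it.\<close>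

definition col_sq :: "complex mat \<Rightarrow> nat \<Rightarrow> real" where
  "col_sq M j = (\<Sum>i<dim_row M. (cmod (M $$ (i, j)))\<^sup>2)"

lemma col_sq_nonneg [simp]: "0 \<le> col_sq M j"
  unfolding col_sq_def by (intro sum_nonneg) auto

lemma gram_index:
  fixes M :: "complex mat"
  assumes "i < dim_col M" "j < dim_col M"
  shows "(mat_adjoint M * M) $$ (i, j) = (\<Sum>k<dim_row M. cnj (M $$ (k, i)) * M $$ (k, j))"
  using assms by (simp add: scalar_prod_def lessThan_atLeast0)

lemma gram_diagonal:
  assumes "j < dim_col M"
  shows "(mat_adjoint M * M) $$ (j, j) = of_real (col_sq M j)"
  using assms
  by (simp add: gram_index col_sq_def complex_norm_square[symmetric] mult.commute[of "cnj _"]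
      del: index_mult_mat of_real_power)

lemma unitary_matD:
  assumes "unitary_mat n U"
  shows "U \<in> carrier_mat n n" "mat_adjoint U \<in> carrier_mat n n"
    "mat_adjoint U * U = 1\<^sub>m n" "U * mat_adjoint U = 1\<^sub>m n"
  using assms unitary_mat_right mat_adjoint_carrier unfolding unitary_mat_def by auto

lemma unitary_mat_mult:
  assumes U: "unitary_mat n U" and V: "unitary_mat n V"
  shows "unitary_mat n (U * V)"
proof -
  note Ud = unitary_matD[OF U] and Vd = unitary_matD[OF V]
  have "mat_adjoint (U * V) * (U * V) = mat_adjoint V * (mat_adjoint U * (U * V))"
    using Ud(1,2) Vd(1,2)
    by (simp add: mat_adjoint_mult[of U n n V n] assoc_mult_mat[of "mat_adjoint V" n n _ n _ n])
  also have "mat_adjoint U * (U * V) = V"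
    using assoc_mult_mat[OF Ud(2,1) Vd(1)] Ud(3) Vd(1) by simp
  finally show ?thesis using Ud(1) Vd(1,3) by (simp add: unitary_mat_def)
qed

lemma unitary_mat_four_block:
  assumes U: "unitary_mat m U" and V: "unitary_mat n V"
  shows "unitary_mat (m + n) (four_block_mat U (0\<^sub>m m n) (0\<^sub>m n m) V)"
proof -
  note [simp] = unitary_matD[OF U] unitary_matD[OF V]
  show ?thesis
    by (simp add: unitary_mat_def mat_adjoint_four_block[of _ m m _ n _ n]
        mult_four_block_mat[of _ m m _ n _ n _ _ m _ n] left_mult_zero_mat[of _ n n]
        left_mult_zero_mat[of _ m m] right_mult_zero_mat[of _ n n] right_mult_zero_mat[of _ m m])
qed

text \<open>Complete \<open>v\<close> to a basis, orthogonalise by Gram-Schmidt, which keeps the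
  first vector, and scale the columns to unit length. The scalar \<open>c\<close> is the scaling
  factor of the first column.\<close>

lemma unitary_mat_first_col:
  assumes v: "v \<in> carrier_vec n" "v \<noteq> 0\<^sub>v n"
  shows "\<exists>U c. unitary_mat n U \<and> col U 0 = c \<cdot>\<^sub>v v"
proof -
  interpret cof_vec_space n "TYPE(complex)" .
  define b where "b = basis_completion v"
  define ws where "ws = gram_schmidt n b"
  define W where "W = mat_of_cols n ws"
  note bc = basis_completion[OF v, folded b_def]
  have n: "n \<noteq> 0" using v by auto
  from bc(6,7) n obtain vs where bv: "b = v # vs" by (cases b) auto
  from gram_schmidt_result[OF bc(2,4,5) ws_def] bc(6)
  have ws: "set ws \<subseteq> carrier_vec n" "corthogonal ws" "length ws = n" by auto
  have hd: "hd ws = v" using gram_schmidt_hd[OF v(1), of vs] bv ws_def by simp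
  have W: "W \<in> carrier_mat n n"
    using ws mat_of_cols_carrier(1)[of n ws] unfolding W_def by auto
  have "corthogonal_mat W" unfolding W_def by (rule orthogonal_mat_of_cols[OF ws])
  hence diag: "diagonal_mat (mat_adjoint W * W)" and nz: "\<And>j. j < n \<Longrightarrow> col_sq W j \<noteq> 0"
    using W gram_diagonal[of _ W] unfolding corthogonal_mat_def Let_def by fastforce+
  define s where "s j = complex_of_real (1 / sqrt (col_sq W j))" for j
  define S where "S = mat_diag n s"
  have US: "W * S = mat n n (\<lambda>(i,j). W $$ (i,j) * s j)"
    unfolding S_def by (rule mat_diag_mult_right[OF W])
  have "mat_adjoint (W * S) * (W * S) = 1\<^sub>m n"
  proof (rule eq_matI)
    fix i j assume "i < dim_row (1\<^sub>m n :: complex mat)" "j < dim_col (1\<^sub>m n :: complex mat)"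
    hence ij: "i < n" "j < n" by auto
    have "(mat_adjoint (W * S) * (W * S)) $$ (i, j)
        = cnj (s i) * s j * (mat_adjoint W * W) $$ (i, j)"
      using ij W by (simp add: US gram_index sum_distrib_left algebra_simps del: index_mult_mat)
    also have "\<dots> = 1\<^sub>m n $$ (i, j)"
    proof (cases "i = j")
      case True
      have "(1 / sqrt (col_sq W j)) * (1 / sqrt (col_sq W j)) * col_sq W j = 1"
        using nz[OF ij(2)] by (simp add: field_simps)
      hence "complex_of_real ((1 / sqrt (col_sq W j)) * (1 / sqrt (col_sq W j)) * col_sq W j) = 1"
        by (simp only: of_real_1)
      hence "cnj (s j) * s j * of_real (col_sq W j) = 1"
        by (simp only: s_def complex_cnj_complex_of_real of_real_mult)
      thus ?thesis using True ij gram_diagonal[of j W] W by simp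
    next
      case False
      thus ?thesis using diag ij W by (simp add: diagonal_mat_def)
    qed
    finally show "(mat_adjoint (W * S) * (W * S)) $$ (i, j) = 1\<^sub>m n $$ (i, j)" .
  qed (auto simp: US)
  hence "unitary_mat n (W * S)" by (simp add: unitary_mat_def US)
  moreover have "col (W * S) 0 = s 0 \<cdot>\<^sub>v v"
  proof -
    have "col W 0 = v"
      using hd ws n unfolding W_def by (cases ws) auto
    thus ?thesis using n W v
      by (intro eq_vecI) (auto simp: US mult.commute)
  qed
  ultimately show ?thesis by blast
qed

section \<open>The spectral theorem\<close>

text \<open>Deflation: an eigenvector, completed to a unitary matrix, makes the first column of the
  conjugated matrix vanish below the diagonal. Symmetry then clears the first row, and the remaining
  block is Hermitian of size one less.\<close>

theorem hermitian_diagonalisation: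
  fixes H :: "complex mat"
  assumes "H \<in> carrier_mat n n" "mat_adjoint H = H"
  shows "\<exists>U (d :: nat \<Rightarrow> real). unitary_mat n U \<and>
    mat_adjoint U * H * U = mat_diag n (\<lambda>i. complex_of_real (d i))"
  using assms
proof (induction n arbitrary: H)
  case 0
  define d :: "nat \<Rightarrow> real" where "d = (\<lambda>_. 0)"
  have "mat_adjoint (1\<^sub>m 0) * H * 1\<^sub>m 0 = mat_diag 0 (\<lambda>i. complex_of_real (d i))"
    by (rule eq_matI) (auto simp: mat_diag_def)
  hence "\<exists>d. unitary_mat 0 (1\<^sub>m 0) \<and>
      mat_adjoint (1\<^sub>m 0) * H * 1\<^sub>m 0 = mat_diag 0 (\<lambda>i. complex_of_real (d i))"
    by (intro exI[of _ d]) (simp add: unitary_mat_def)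
  thus ?case by (rule exI[of _ "1\<^sub>m 0"])
next
  case (Suc n)
  note H = Suc.prems
  \<comment> \<open>The characteristic polynomial splits over the complex numbers into
    \<open>Suc n\<close> linear factors, so there is an eigenvalue.\<close>
  obtain as where as: "char_poly H = (\<Prod>a\<leftarrow>as. [:- a, 1:])" "length as = Suc n"
    using char_poly_factorized[OF H(1)] by blast
  then obtain e es where "as = e # es" by (cases as) auto
  hence "eigenvalue H e" using as eigenvalue_root_char_poly[OF H(1)] by simp
  from find_eigenvector[OF H(1) this] obtain v where
    v: "v \<in> carrier_vec (Suc n)" "v \<noteq> 0\<^sub>v (Suc n)" and ev: "H *\<^sub>v v = e \<cdot>\<^sub>v v"
    using H(1) unfolding eigenvector_def by auto
  obtain U c where U: "unitary_mat (Suc n) U" and Uc: "col U 0 = c \<cdot>\<^sub>v v"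
    using unitary_mat_first_col[OF v] by blast
  note Ud = unitary_matD[OF U]
  define H' where "H' = mat_adjoint U * H * U"
  have H'c: "H' \<in> carrier_mat (Suc n) (Suc n)" using H Ud unfolding H'_def by simp
  have H'ad: "mat_adjoint H' = H'"
    unfolding H'_def using H Ud
    by (simp add: mat_adjoint_mult[of _ "Suc n" "Suc n" _ "Suc n"] assoc_mult_mat[of _ "Suc n" "Suc n" _ "Suc n" _ "Suc n"])
  \<comment> \<open>Column 0 of \<open>U\<close> is an eigenvector, so column 0 of \<open>H'\<close>
    is \<open>e\<close> times column 0 of \<open>mat_adjoint U * U\<close>.\<close>
  have col0: "H' $$ (i, 0) = (if i = 0 then e else 0)" if i: "i < Suc n" for i
  proof -
    have "col (H * U) 0 = H *\<^sub>v col U 0" by (rule col_mult2[OF H(1) Ud(1)]) simp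
    also have "\<dots> = e \<cdot>\<^sub>v col U 0"
      unfolding Uc using mult_mat_vec[OF H(1) v(1)] ev v by (simp add: smult_smult_assoc mult.commute)
    finally have c: "col (H * U) 0 = e \<cdot>\<^sub>v col U 0" .
    have "H' = mat_adjoint U * (H * U)"
      unfolding H'_def using H Ud by (simp add: assoc_mult_mat[of _ "Suc n" "Suc n" _ "Suc n" _ "Suc n"])
    hence "H' $$ (i, 0) = scalar_prod (row (mat_adjoint U) i) (col (H * U) 0)"
      using i H Ud by simp
    also have "\<dots> = e * (scalar_prod (row (mat_adjoint U) i) (col U 0))"
      unfolding c using Ud(1,2) i row_carrier_vec[of i "Suc n" "mat_adjoint U"] col_carrier_vec[of 0 "Suc n" U]
      by (simp add: scalar_prod_smult_distrib[of _ "Suc n"])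
    also have "scalar_prod (row (mat_adjoint U) i) (col U 0) = (mat_adjoint U * U) $$ (i, 0)"
      using i Ud(1,2) by simp
    finally show ?thesis using i Ud(3) by simp
  qed
  have row0: "H' $$ (0, i) = 0" if i: "i < Suc n" "i \<noteq> 0" for i
    using col0[of i] i H'c mat_adjoint_index[of 0 H' i] H'ad by simp
  have ereal: "e = complex_of_real (Re e)"
    using col0[of 0] H'c mat_adjoint_index[of 0 H' 0] H'ad
    by (metis Reals_cnj_iff carrier_matD of_real_Re zero_less_Suc)
  define H3 where "H3 = mat n n (\<lambda>(i,j). H' $$ (Suc i, Suc j))"
  have H3: "H3 \<in> carrier_mat n n" unfolding H3_def by simp
  have sym: "cnj (H' $$ (Suc j, Suc i)) = H' $$ (Suc i, Suc j)" if "i < n" "j < n" for i j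
    using mat_adjoint_index[of "Suc i" H' "Suc j"] H'ad H'c that by simp
  have "mat_adjoint H3 = H3"
    unfolding H3_def by (intro eq_matI) (simp_all add: sym)
  from Suc.IH[OF H3 this] obtain V d where V: "unitary_mat n V"
    and Vd: "mat_adjoint V * H3 * V = mat_diag n (\<lambda>i. complex_of_real (d i))" by blast
  note Vc = unitary_matD[OF V]
  define P where "P = four_block_mat (1\<^sub>m 1) (0\<^sub>m 1 n) (0\<^sub>m n 1) V"
  have P: "unitary_mat (Suc n) P"
    using unitary_mat_four_block[OF _ V, of 1 "1\<^sub>m 1"] unfolding P_def by (simp add: unitary_mat_def)
  note Pd = unitary_matD[OF P]
  define E where "E = mat 1 1 (\<lambda>_. e)"
  have E: "E \<in> carrier_mat 1 1" unfolding E_def by simp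
  have H'4: "H' = four_block_mat E (0\<^sub>m 1 n) (0\<^sub>m n 1) H3"
    using H'c col0 row0 unfolding E_def H3_def by (intro eq_matI) auto
  have "mat_adjoint (U * P) * H * (U * P) = mat_adjoint P * H' * P"
    unfolding H'_def using H Ud Pd
    by (simp add: mat_adjoint_mult[of _ "Suc n" "Suc n" _ "Suc n"] assoc_mult_mat[of _ "Suc n" "Suc n" _ "Suc n" _ "Suc n"])
  also have "\<dots> = four_block_mat E (0\<^sub>m 1 n) (0\<^sub>m n 1) (mat_adjoint V * H3 * V)"
    unfolding H'4 P_def using E H3 Vc
    by (simp add: mat_adjoint_four_block[of _ 1 1 _ n _ n] mult_four_block_mat[of _ 1 1 _ n _ n _ _ 1 _ n]
        left_mult_one_mat[of E 1 1] right_mult_one_mat[of E 1 1] left_add_zero_mat[of _ n n]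
        right_add_zero_mat[of E 1 1])
  \<comment> \<open>Position 0 holds the eigenvalue just split off, which is real by
    \<open>ereal\<close>; hence the index of \<open>d\<close> shifts by one.\<close>
  also have "\<dots> = mat_diag (Suc n) (\<lambda>i. complex_of_real (if i = 0 then Re e else d (i - 1)))"
    unfolding Vd using ereal by (intro eq_matI) (auto simp: mat_diag_def E_def)
  finally show ?case using unitary_mat_mult[OF U P] by (intro exI[of _ "U * P"] exI[of _ "\<lambda>i. if i = 0 then Re e else d (i - 1)"]) blast
qed

section \<open>Convexity of real powers\<close>

text \<open>Convexity in tangent form. For positive \<open>x\<close> and \<open>y\<close> it is
  Young's inequality for \<open>x powr q\<close> and \<open>y powr q\<close> with weights
  \<open>1 / q\<close> and \<open>1 - 1 / q\<close>.\<close>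

lemma powr_tangent_le:
  fixes x y q :: real
  assumes "1 \<le> q" "0 \<le> x" "0 \<le> y"
  shows "y powr q + q * y powr (q - 1) * (x - y) \<le> x powr q"
proof (cases "x = 0 \<or> y = 0")
  \<comment> \<open>\<open>0 powr r\<close> is 0 for every \<open>r\<close>, also for
    \<open>r = 0\<close>, so the left side vanishes when \<open>y = 0\<close>. When
    \<open>x = 0 < y\<close> it equals \<open>(1 - q) * y powr q\<close>.\<close>
  case True
  have "y powr (q - 1) * y = y powr q" if "y > 0" using that powr_add[of y "q - 1" 1] by simp
  thus ?thesis using True assms by (cases "y = 0") (auto simp: mult.assoc)
next
  case False
  hence pos: "x > 0" "y > 0" using assms by auto
  have "(x powr q) powr (1 / q) * (y powr q) powr (1 - 1 / q)
      \<le> (1 / q) * x powr q + (1 - 1 / q) * y powr q"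
    using assms pos by (intro Youngs_inequality_0) auto
  moreover have "(x powr q) powr (1 / q) = x" using assms pos by (simp add: powr_powr)
  moreover have "(y powr q) powr (1 - 1 / q) = y powr (q - 1)"
    using assms by (simp add: powr_powr right_diff_distrib)
  ultimately have "q * (x * y powr (q - 1)) \<le> q * ((1 / q) * x powr q + (1 - 1 / q) * y powr q)"
    using assms by (intro mult_left_mono) auto
  also have "\<dots> = x powr q + (q - 1) * y powr q" using assms by (simp add: field_simps)
  finally have "q * (x * y powr (q - 1)) \<le> x powr q + (q - 1) * y powr q" .
  moreover have "y powr (q - 1) * y = y powr q" using pos powr_add[of y "q - 1" 1] by simp
  ultimately show ?thesis by (simp add: algebra_simps)
qed

text \<open>Jensen's inequality for weights of total mass at most 1. Sum the tangent at the weighted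
  sum \<open>y\<close>: its value at 0 is \<open>- (q - 1) * y powr q\<close>, which is at most 0,
  so missing mass only helps.\<close>

lemma powr_sum_subconvex:
  fixes d w :: "'a \<Rightarrow> real"
  assumes q: "1 \<le> q" and d: "\<And>i. i \<in> I \<Longrightarrow> 0 \<le> d i" and w: "\<And>i. i \<in> I \<Longrightarrow> 0 \<le> w i"
    and s: "(\<Sum>i\<in>I. w i) \<le> 1"
  shows "(\<Sum>i\<in>I. d i * w i) powr q \<le> (\<Sum>i\<in>I. d i powr q * w i)"
proof -
  define y where "y = (\<Sum>i\<in>I. d i * w i)"
  have y: "0 \<le> y" unfolding y_def using d w by (intro sum_nonneg) auto
  have yq: "y powr (q - 1) * y = y powr q"
    using y powr_add[of y "q - 1" 1] by (cases "y = 0") auto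
  have "y powr q \<le> q * y powr q - (q - 1) * y powr q * (\<Sum>i\<in>I. w i)"
  proof -
    have "(q - 1) * y powr q * (\<Sum>i\<in>I. w i) \<le> (q - 1) * y powr q * 1"
      using q s by (intro mult_left_mono) auto
    thus ?thesis by (simp add: algebra_simps)
  qed
  also have "\<dots> = q * y powr (q - 1) * y - (q - 1) * y powr q * (\<Sum>i\<in>I. w i)"
    using yq by (simp add: mult.assoc)
  also have "\<dots> = (\<Sum>i\<in>I. (y powr q + q * y powr (q - 1) * (d i - y)) * w i)"
  proof -
    have "(y powr q + q * y powr (q - 1) * (d i - y)) * w i
        = q * y powr (q - 1) * (d i * w i) - (q - 1) * y powr q * w i" for i
      unfolding yq[symmetric] by (simp add: algebra_simps)
    thus ?thesis by (simp add: sum_subtractf sum_distrib_left[symmetric] y_def[symmetric])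
  qed
  also have "\<dots> \<le> (\<Sum>i\<in>I. d i powr q * w i)"
    using q d w y powr_tangent_le[of q _ y] by (intro sum_mono mult_right_mono) auto
  finally show ?thesis unfolding y_def .
qed

text \<open>Both terms on the right are bounded by the tangent at the common mean \<open>s\<close>;
  the first-order parts cancel because \<open>s * (\<alpha> + \<beta>) = a + b\<close>.\<close>

lemma powr_perspective_le:
  fixes a b \<alpha> \<beta> p :: real
  assumes "1 \<le> p" "0 \<le> a" "0 \<le> b" "0 < \<alpha>" "0 < \<beta>"
  shows "(\<alpha> + \<beta>) * ((a + b) / (\<alpha> + \<beta>)) powr p \<le> \<alpha> * (a / \<alpha>) powr p + \<beta> * (b / \<beta>) powr p"
proof -
  define s where "s = (a + b) / (\<alpha> + \<beta>)"
  have s: "0 \<le> s" "s * (\<alpha> + \<beta>) = a + b" using assms unfolding s_def by auto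
  have "\<alpha> * (s powr p + p * s powr (p - 1) * (a / \<alpha> - s)) \<le> \<alpha> * (a / \<alpha>) powr p"
    using assms s by (intro mult_left_mono powr_tangent_le) auto
  moreover have "\<beta> * (s powr p + p * s powr (p - 1) * (b / \<beta> - s)) \<le> \<beta> * (b / \<beta>) powr p"
    using assms s by (intro mult_left_mono powr_tangent_le) auto
  moreover have "\<alpha> * (s powr p + p * s powr (p - 1) * (a / \<alpha> - s))
      + \<beta> * (s powr p + p * s powr (p - 1) * (b / \<beta> - s))
      = (\<alpha> + \<beta>) * s powr p + p * s powr (p - 1) * (a + b - s * (\<alpha> + \<beta>))"
    using assms by (simp add: field_simps)
  ultimately show ?thesis using s(2) unfolding s_def[symmetric] by simp
qed

text \<open>Minkowski's inequality with positive bounds \<open>\<alpha>\<close>,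
  \<open>\<beta>\<close> in place of the two norms, so that one can divide by them. After scaling it
  is the perspective inequality summed over \<open>i\<close>.\<close>

lemma minkowski_powr:
  fixes a b :: "'a \<Rightarrow> real"
  assumes p: "1 \<le> p" and ab: "\<And>i. i \<in> I \<Longrightarrow> 0 \<le> a i" "\<And>i. i \<in> I \<Longrightarrow> 0 \<le> b i"
    and pos: "0 < \<alpha>" "0 < \<beta>"
    and le: "(\<Sum>i\<in>I. a i powr p) \<le> \<alpha> powr p" "(\<Sum>i\<in>I. b i powr p) \<le> \<beta> powr p"
  shows "(\<Sum>i\<in>I. (a i + b i) powr p) \<le> (\<alpha> + \<beta>) powr p"
proof -
  have *: "(\<Sum>i\<in>I. (f i / c) powr p) = (\<Sum>i\<in>I. f i powr p) / c powr p"
    if "\<And>i. i \<in> I \<Longrightarrow> 0 \<le> f i" "0 < c" for f and c :: real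
    using that by (simp add: powr_divide sum_divide_distrib)
  have "(\<alpha> + \<beta>) * (\<Sum>i\<in>I. ((a i + b i) / (\<alpha> + \<beta>)) powr p)
      \<le> \<alpha> * (\<Sum>i\<in>I. (a i / \<alpha>) powr p) + \<beta> * (\<Sum>i\<in>I. (b i / \<beta>) powr p)"
    unfolding sum_distrib_left sum.distrib[symmetric]
    using p ab pos by (intro sum_mono powr_perspective_le) auto
  also have "\<dots> \<le> \<alpha> * 1 + \<beta> * 1"
    using le pos ab by (intro add_mono mult_left_mono) (auto simp: *)
  finally have "(\<Sum>i\<in>I. ((a i + b i) / (\<alpha> + \<beta>)) powr p) \<le> 1"
    using pos by simp
  thus ?thesis using ab pos by (simp add: *)
qed

lemma le_if_powr_le:
  fixes x y p :: real
  assumes "x powr p \<le> y powr p" "0 < p" "0 \<le> y"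
  shows "x \<le> y"
  using assms powr_less_mono2[of p y x] by (meson not_less)

section \<open>The variational formula for Schatten norms\<close>

lemma mat_trace_commute:
  assumes "A \<in> carrier_mat m n" "B \<in> carrier_mat n m"
  shows "mat_trace (A * B) = mat_trace (B * A)"
proof -
  have "mat_trace (A * B) = (\<Sum>i<m. \<Sum>k<n. A $$ (i, k) * B $$ (k, i))"
    using assms by (simp add: mat_trace_def scalar_prod_def lessThan_atLeast0)
  also have "\<dots> = (\<Sum>k<n. \<Sum>i<m. A $$ (i, k) * B $$ (k, i))" by (rule sum.swap)
  also have "\<dots> = mat_trace (B * A)"
    using assms by (simp add: mat_trace_def scalar_prod_def lessThan_atLeast0 mult.commute)
  finally show ?thesis .
qed

text \<open>For \<open>M = T * V\<close> with \<open>V\<close> unitary this is the sum in the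
  variational formula, taken over the orthonormal basis formed by the columns of
  \<open>V\<close>.\<close>

definition col_powr_sum :: "real \<Rightarrow> complex mat \<Rightarrow> real" where
  "col_powr_sum p M = (\<Sum>j<dim_col M. col_sq M j powr (p / 2))"

lemma col_powr_sum_nonneg [simp]: "0 \<le> col_powr_sum p M"
  unfolding col_powr_sum_def by (intro sum_nonneg) auto

lemma gram_eq_mat_diag:
  assumes M: "M \<in> carrier_mat m n" and D: "mat_adjoint M * M = mat_diag n f"
  shows "mat_adjoint M * M = mat_diag n (\<lambda>j. complex_of_real (col_sq M j))"
proof -
  have "f j = of_real (col_sq M j)" if "j < n" for j
    using gram_diagonal[of j M] M that unfolding D by (simp add: mat_diag_def)
  thus ?thesis unfolding D by (intro eq_matI) (auto simp: mat_diag_def)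
qed

text \<open>Hypothesis \<open>D\<close> says that the columns of \<open>T * V\<close> are
  orthogonal, that is, \<open>V\<close> diagonalises the Gram matrix of \<open>T\<close>. The
  eigenvalues are the squared column norms, and \<open>psd_powr_eqI\<close> reads off the power
  whose trace defines the norm.\<close>

lemma schatten_norm_eq_col_powr_sum:
  assumes T: "T \<in> carrier_mat m n" and V: "unitary_mat n V"
    and D: "mat_adjoint (T * V) * (T * V) = mat_diag n f"
  shows "schatten_norm p T = col_powr_sum p (T * V) powr (1 / p)"
proof -
  note Vd = unitary_matD[OF V]
  define d where "d = col_sq (T * V)"
  have TV: "T * V \<in> carrier_mat m n" using T Vd by simp
  have Tad: "mat_adjoint T \<in> carrier_mat n m" using T by (rule mat_adjoint_carrier)
  define P where "P = V * mat_diag n (\<lambda>i. complex_of_real (d i powr (p / 2))) * mat_adjoint V"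
  have "mat_adjoint V * (mat_adjoint T * T) * V = mat_adjoint (T * V) * (T * V)"
    using T Vd(1,2) Tad
    by (simp add: mat_adjoint_mult[of T m n V n] assoc_mult_mat[of "mat_adjoint V" n n _ m _ n]
      assoc_mult_mat[of "mat_adjoint V" n n _ n _ n] assoc_mult_mat[of "mat_adjoint T" n m _ n _ n])
  hence diag: "mat_adjoint V * (mat_adjoint T * T) * V = mat_diag n (\<lambda>i. complex_of_real (d i))"
    unfolding d_def using gram_eq_mat_diag[OF TV D] by simp
  have G: "mat_adjoint T * T \<in> carrier_mat n n" using T Tad by simp
  have "V * (mat_adjoint V * (mat_adjoint T * T) * V) * mat_adjoint V
      = (V * mat_adjoint V) * (mat_adjoint T * T) * (V * mat_adjoint V)"
    using G Vd(1,2) by (simp add: assoc_mult_mat[of _ n n _ n _ n])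
  also have "\<dots> = mat_adjoint T * T" using left_mult_one_mat[OF G] right_mult_one_mat[OF G] by (simp add: Vd(4))
  finally have "mat_adjoint T * T = V * mat_diag n (\<lambda>i. complex_of_real (d i)) * mat_adjoint V"
    unfolding diag by simp
  hence "is_psd_powr (mat_adjoint T * T) (p / 2) P"
    unfolding is_psd_powr_def Let_def P_def using T V Vd(1)
    by (intro exI[of _ V] exI[of _ d]) (auto simp: d_def)
  hence "psd_powr (mat_adjoint T * T) (p / 2) = P" by (rule psd_powr_eqI)
  moreover have "mat_trace P = of_real (\<Sum>i<n. d i powr (p / 2))"
  proof -
    let ?D = "mat_diag n (\<lambda>i. complex_of_real (d i powr (p / 2)))"
    have "mat_trace P = mat_trace (mat_adjoint V * (V * ?D))"
      unfolding P_def using Vd(1,2) by (intro mat_trace_commute[of _ n n]) auto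
    also have "mat_adjoint V * (V * ?D) = ?D"
      using Vd(1,2,3) assoc_mult_mat[of "mat_adjoint V" n n V n ?D n, symmetric]
        left_mult_one_mat[of ?D n n] by simp
    finally show ?thesis by (simp add: mat_trace_def mat_diag_def)
  qed
  ultimately show ?thesis
    using TV Vd(1) by (simp add: schatten_norm_def col_powr_sum_def d_def del: of_real_sum)
qed

text \<open>The basis comes from the spectral theorem for \<open>mat_adjoint T * T\<close>.\<close>

lemma schatten_norm_attained:
  assumes T: "T \<in> carrier_mat m n" and p: "0 < p"
  obtains V f where "unitary_mat n V" "mat_adjoint (T * V) * (T * V) = mat_diag n f"
    "schatten_norm p T powr p = col_powr_sum p (T * V)"
proof -
  have Tad: "mat_adjoint T \<in> carrier_mat n m" using T by (rule mat_adjoint_carrier)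
  have "mat_adjoint (mat_adjoint T * T) = mat_adjoint T * T"
    using T Tad by (simp add: mat_adjoint_mult[of _ n m _ n])
  then obtain V d where V: "unitary_mat n V"
    and D: "mat_adjoint V * (mat_adjoint T * T) * V = mat_diag n (\<lambda>i. complex_of_real (d i))"
    using hermitian_diagonalisation[of "mat_adjoint T * T" n] T Tad by auto
  note Vd = unitary_matD[OF V]
  have "mat_adjoint (T * V) * (T * V) = mat_adjoint V * (mat_adjoint T * T) * V"
    using T Vd(1,2) Tad
    by (simp add: mat_adjoint_mult[of T m n V n] assoc_mult_mat[of "mat_adjoint V" n n _ m _ n]
      assoc_mult_mat[of "mat_adjoint V" n n _ n _ n] assoc_mult_mat[of "mat_adjoint T" n m _ n _ n])
  with D have D': "mat_adjoint (T * V) * (T * V) = mat_diag n (\<lambda>i. complex_of_real (d i))" by simp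
  show ?thesis
    using that[OF V D'] schatten_norm_eq_col_powr_sum[OF T V D', of p] p
    by (simp add: powr_powr)
qed

lemma schatten_norm_nonneg [simp]: "0 \<le> schatten_norm p T"
  by (simp add: schatten_norm_def)

text \<open>This algebraic form covers rectangular matrices and zero columns, both of which occur in
  the comparison of \<open>T\<close> with its adjoint, and it contains the unitary matrices.\<close>

definition partial_isometry :: "complex mat \<Rightarrow> bool" where
  "partial_isometry W \<longleftrightarrow> W * mat_adjoint W * W = W"

lemma partial_isometry_unitary: "unitary_mat n U \<Longrightarrow> partial_isometry U"
  using unitary_matD[of n U] by (simp add: partial_isometry_def)

lemma partial_isometry_adjoint:
  assumes W: "partial_isometry W"
  shows "partial_isometry (mat_adjoint W)"
proof -
  define n k where "n = dim_row W" and "k = dim_col W"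
  have c: "W \<in> carrier_mat n k" "mat_adjoint W \<in> carrier_mat k n"
    unfolding n_def k_def by (auto intro: mat_adjoint_carrier)
  have "mat_adjoint (W * mat_adjoint W * W) = mat_adjoint W * mat_adjoint (W * mat_adjoint W)"
    using c by (intro mat_adjoint_mult[of _ n n _ k]) auto
  also have "mat_adjoint (W * mat_adjoint W) = W * mat_adjoint W"
    using c by (simp add: mat_adjoint_mult[of _ n k _ n])
  also have "mat_adjoint W * (W * mat_adjoint W) = mat_adjoint W * W * mat_adjoint W"
    by (rule assoc_mult_mat[OF c(2,1,2), symmetric])
  finally show ?thesis using W by (simp add: partial_isometry_def)
qed

lemma partial_isometry_unitary_mult:
  assumes V: "unitary_mat n V" and W: "partial_isometry W" "W \<in> carrier_mat n k"
  shows "partial_isometry (mat_adjoint V * W)"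
proof -
  note Vd = unitary_matD[OF V]
  have Wad: "mat_adjoint W \<in> carrier_mat k n" using W by (intro mat_adjoint_carrier)
  have "mat_adjoint (mat_adjoint V * W) = mat_adjoint W * V"
    using Vd W by (simp add: mat_adjoint_mult[of _ n n _ k])
  moreover have "mat_adjoint W * V * (mat_adjoint V * W) = mat_adjoint W * (V * mat_adjoint V * W)"
    using Vd(1,2) W(2) Wad
    by (simp add: assoc_mult_mat[of _ k n _ n _ k] assoc_mult_mat[of _ n n _ n _ k])
  moreover have "mat_adjoint V * W * (mat_adjoint W * W) = mat_adjoint V * (W * mat_adjoint W * W)"
    using Vd(1,2) W(2) Wad
    by (simp add: assoc_mult_mat[of _ n n _ k _ k] assoc_mult_mat[of _ n k _ n _ k])
  moreover have "mat_adjoint V * W * (mat_adjoint W * V) * (mat_adjoint V * W)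
      = mat_adjoint V * W * (mat_adjoint W * V * (mat_adjoint V * W))"
    using Vd(1,2) W(2) Wad by (intro assoc_mult_mat[of _ n k _ n _ k]) auto
  ultimately show ?thesis using Vd(4) W by (simp add: partial_isometry_def)
qed

text \<open>\<open>P = mat_adjoint W * W\<close> is an orthogonal projection. Its entry
  \<open>x\<close> at \<open>(j, j)\<close> is the squared norm of column \<open>j\<close> of
  \<open>W\<close> and, since \<open>mat_adjoint P * P = P\<close>, also that of column
  \<open>j\<close> of \<open>P\<close>. The latter is at least the square of \<open>x\<close>, so
  \<open>x\<close> is at most 1.\<close>

lemma partial_isometry_col_sq_le:
  assumes W: "partial_isometry W" and j: "j < dim_col W"
  shows "col_sq W j \<le> 1"
proof -
  define n k where "n = dim_row W" and "k = dim_col W"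
  have c: "W \<in> carrier_mat n k" "mat_adjoint W \<in> carrier_mat k n"
    unfolding n_def k_def by (auto intro: mat_adjoint_carrier)
  define P where "P = mat_adjoint W * W"
  have P: "P \<in> carrier_mat k k" using c unfolding P_def by simp
  have "mat_adjoint P = P"
    unfolding P_def using c by (simp add: mat_adjoint_mult[of _ k n _ k])
  moreover have "P * P = mat_adjoint W * (W * P)"
    unfolding P_def using c by (intro assoc_mult_mat[of _ k n _ k _ k]) auto
  moreover have "W * P = W"
    using W assoc_mult_mat[OF c(1,2,1)] unfolding P_def partial_isometry_def by simp
  ultimately have PP: "mat_adjoint P * P = P" by (simp add: P_def)
  have "j < dim_col P" using P j unfolding k_def by simp
  from gram_diagonal[OF this] gram_diagonal[OF j]
  have "P $$ (j, j) = of_real (col_sq P j)" and Pjj: "P $$ (j, j) = of_real (col_sq W j)"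
    unfolding PP P_def[symmetric] .
  hence "col_sq P j = col_sq W j" by (metis of_real_eq_iff)
  moreover have "(cmod (P $$ (j, j)))\<^sup>2 \<le> col_sq P j"
    unfolding col_sq_def using P j k_def
    by (intro member_le_sum[of j _ "\<lambda>i. (cmod (P $$ (i, j)))\<^sup>2"]) auto
  moreover have "cmod (P $$ (j, j)) = col_sq W j"
    unfolding Pjj by simp
  ultimately have "(col_sq W j)\<^sup>2 \<le> col_sq W j" by simp
  thus ?thesis
    using mult_strict_right_mono[of 1 "col_sq W j" "col_sq W j"]
    by (cases "col_sq W j \<le> 1") (simp_all add: power2_eq_square)
qed

text \<open>Pythagoras: column \<open>j\<close> of \<open>M * Q\<close> combines the orthogonal
  columns of \<open>M\<close> with the coefficients in column \<open>j\<close> of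
  \<open>Q\<close>.\<close>

lemma col_sq_mult_orthogonal:
  assumes M: "M \<in> carrier_mat m n" and D: "mat_adjoint M * M = mat_diag n f"
    and Q: "Q \<in> carrier_mat n k" and j: "j < k"
  shows "col_sq (M * Q) j = (\<Sum>l<n. col_sq M l * (cmod (Q $$ (l, j)))\<^sup>2)"
proof -
  have c: "mat_adjoint M \<in> carrier_mat n m" "mat_adjoint Q \<in> carrier_mat k n"
    using M Q by (auto intro: mat_adjoint_carrier)
  have "mat_adjoint (M * Q) * (M * Q) = mat_adjoint Q * (mat_adjoint M * M * Q)"
    using c M Q by (simp add: mat_adjoint_mult[of _ m n _ k] assoc_mult_mat[of _ k n _ m _ k]
        assoc_mult_mat[of _ n m _ n _ k])
  also have "\<dots> = mat_adjoint Q * mat n k (\<lambda>(l, j). of_real (col_sq M l) * Q $$ (l, j))"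
    unfolding gram_eq_mat_diag[OF M D] mat_diag_mult_left[OF Q] ..
  finally have "(mat_adjoint (M * Q) * (M * Q)) $$ (j, j)
      = (\<Sum>l<n. cnj (Q $$ (l, j)) * (of_real (col_sq M l) * Q $$ (l, j)))"
    using Q j by (simp add: scalar_prod_def lessThan_atLeast0)
  also have "\<dots> = of_real (\<Sum>l<n. col_sq M l * (cmod (Q $$ (l, j)))\<^sup>2)"
    unfolding of_real_sum of_real_mult complex_norm_square
    by (simp add: mult_ac)
  finally show ?thesis
    using gram_diagonal[of j "M * Q"] j Q by (simp del: index_mult_mat(1) of_real_sum)
qed

text \<open>Peierls' inequality: a partial isometry redistributes the squared singular values by a
  doubly substochastic array, and \<open>t \<mapsto> t powr (p / 2)\<close> is convex because \<open>p \<ge> 2\<close>.\<close>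

lemma col_powr_sum_le_schatten_norm:
  assumes p: "2 \<le> p" and T: "T \<in> carrier_mat m n"
    and W: "W \<in> carrier_mat n k" "partial_isometry W"
  shows "col_powr_sum p (T * W) \<le> schatten_norm p T powr p"
proof -
  obtain V f where V: "unitary_mat n V" and D: "mat_adjoint (T * V) * (T * V) = mat_diag n f"
    and norm: "schatten_norm p T powr p = col_powr_sum p (T * V)"
    using schatten_norm_attained[OF T, of p] p by auto
  note Vd = unitary_matD[OF V]
  define M where "M = T * V"
  define Q where "Q = mat_adjoint V * W"
  have M: "M \<in> carrier_mat m n" and Q: "Q \<in> carrier_mat n k"
    using T Vd W unfolding M_def Q_def by auto
  \<comment> \<open>In the eigenbasis \<open>V\<close> the matrix \<open>T\<close> becomes
    \<open>M\<close>, which has orthogonal columns, and \<open>W\<close> becomes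
    \<open>Q\<close>.\<close>
  have "T * W = M * Q"
    using T W(1) Vd assoc_mult_mat[of V n n "mat_adjoint V" n W k]
    unfolding M_def Q_def by (simp add: assoc_mult_mat[of T m n V n _ k])
  have iso: "partial_isometry Q" unfolding Q_def using V W by (intro partial_isometry_unitary_mult)
  have cols: "(\<Sum>l<n. (cmod (Q $$ (l, j)))\<^sup>2) \<le> 1" if "j < k" for j
    using partial_isometry_col_sq_le[OF iso, of j] that Q by (simp add: col_sq_def)
  \<comment> \<open>The column bound for the adjoint of \<open>Q\<close>. The column sums serve as
    Jensen weights, the row sums finish the estimate once the summations are swapped.\<close>
  have rows: "(\<Sum>j<k. (cmod (Q $$ (l, j)))\<^sup>2) \<le> 1" if "l < n" for l
    using partial_isometry_col_sq_le[OF partial_isometry_adjoint[OF iso], of l] that Q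
    by (simp add: col_sq_def)
  have "col_powr_sum p (M * Q)
      = (\<Sum>j<k. (\<Sum>l<n. col_sq M l * (cmod (Q $$ (l, j)))\<^sup>2) powr (p / 2))"
    using Q col_sq_mult_orthogonal[OF M D[folded M_def] Q] by (simp add: col_powr_sum_def)
  also have "\<dots> \<le> (\<Sum>j<k. \<Sum>l<n. col_sq M l powr (p / 2) * (cmod (Q $$ (l, j)))\<^sup>2)"
    using p cols by (intro sum_mono powr_sum_subconvex) auto
  also have "\<dots> = (\<Sum>l<n. col_sq M l powr (p / 2) * (\<Sum>j<k. (cmod (Q $$ (l, j)))\<^sup>2))"
    unfolding sum_distrib_left by (rule sum.swap)
  also have "\<dots> \<le> (\<Sum>l<n. col_sq M l powr (p / 2) * 1)"
    using rows by (intro sum_mono mult_left_mono) auto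
  finally show ?thesis
    unfolding norm \<open>T * W = M * Q\<close> using M by (simp add: col_powr_sum_def M_def[symmetric])
qed

section \<open>Schatten norm inequalities\<close>

lemma col_sq_smult:
  assumes "j < dim_col M"
  shows "col_sq (c \<cdot>\<^sub>m M) j = (cmod c)\<^sup>2 * col_sq M j"
  using assms by (simp add: col_sq_def norm_mult power_mult_distrib sum_distrib_left)

lemma col_sq_mult_diag:
  assumes "A \<in> carrier_mat m n" "j < n"
  shows "col_sq (A * mat_diag n g) j = (cmod (g j))\<^sup>2 * col_sq A j"
  using assms
  by (simp add: col_sq_def mat_diag_mult_right[OF assms(1)] norm_mult power_mult_distrib
      sum_distrib_left mult.commute)

lemma sqrt_col_sq_add_le:
  assumes "A \<in> carrier_mat m n" "B \<in> carrier_mat m n" "j < n"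
  shows "sqrt (col_sq (A + B) j) \<le> sqrt (col_sq A j) + sqrt (col_sq B j)"
proof -
  have "sqrt (col_sq (A + B) j) = L2_set (\<lambda>i. cmod (A $$ (i, j) + B $$ (i, j))) {..<m}"
    using assms by (simp add: col_sq_def L2_set_def)
  also have "\<dots> \<le> L2_set (\<lambda>i. cmod (A $$ (i, j)) + cmod (B $$ (i, j))) {..<m}"
    by (intro L2_set_mono) (auto intro: norm_triangle_ineq)
  also have "\<dots> \<le> L2_set (\<lambda>i. cmod (A $$ (i, j))) {..<m} + L2_set (\<lambda>i. cmod (B $$ (i, j))) {..<m}"
    by (rule L2_set_triangle_ineq)
  finally show ?thesis using assms by (simp add: col_sq_def L2_set_def)
qed

text \<open>The parallelogram law, with the factors of a Cartesian decomposition: for Hermitian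
  \<open>A\<close> and \<open>B\<close> the two sums on the left are adjoint to each other.\<close>

lemma col_sq_parallelogram:
  assumes "A \<in> carrier_mat m n" "B \<in> carrier_mat m n" "j < n"
  shows "col_sq (A + \<i> \<cdot>\<^sub>m B) j + col_sq (A + (- \<i>) \<cdot>\<^sub>m B) j = 2 * (col_sq A j + col_sq B j)"
proof -
  have *: "(cmod (a + \<i> * b))\<^sup>2 + (cmod (a - \<i> * b))\<^sup>2 = 2 * ((cmod a)\<^sup>2 + (cmod b)\<^sup>2)" for a b
    by (simp only: cmod_power2) (simp add: power2_eq_square algebra_simps)
  have "col_sq (A + \<i> \<cdot>\<^sub>m B) j + col_sq (A + (- \<i>) \<cdot>\<^sub>m B) j
      = (\<Sum>i<m. (cmod (A $$ (i, j) + \<i> * B $$ (i, j)))\<^sup>2 + (cmod (A $$ (i, j) - \<i> * B $$ (i, j)))\<^sup>2)"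
    using assms by (simp add: col_sq_def sum.distrib)
  also have "\<dots> = 2 * (\<Sum>i<m. (cmod (A $$ (i, j)))\<^sup>2 + (cmod (B $$ (i, j)))\<^sup>2)"
    by (simp only: * sum_distrib_left)
  finally show ?thesis using assms by (simp add: col_sq_def sum.distrib)
qed

text \<open>Equality holds by symmetry. If \<open>V\<close> diagonalises \<open>T T\<^sup>*\<close>, then normalising the nonzero columns
  of \<open>T\<^sup>* V\<close> gives eigenvectors of \<open>T\<^sup>* T\<close> with the same eigenvalues.\<close>

lemma schatten_norm_adjoint_le:
  assumes p: "2 \<le> p" and T: "T \<in> carrier_mat m n"
  shows "schatten_norm p (mat_adjoint T) \<le> schatten_norm p T"
proof -
  define R where "R = mat_adjoint T"
  have R: "R \<in> carrier_mat n m" using T unfolding R_def by (rule mat_adjoint_carrier)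
  have Rad: "mat_adjoint R = T" unfolding R_def by simp
  obtain V f where V: "unitary_mat m V" and D: "mat_adjoint (R * V) * (R * V) = mat_diag m f"
    and norm: "schatten_norm p R powr p = col_powr_sum p (R * V)"
    using schatten_norm_attained[OF R, of p] p by auto
  note Vd = unitary_matD[OF V]
  define M where "M = R * V"
  define d where "d = col_sq M"
  \<comment> \<open>Zero columns of \<open>M\<close> stay zero, so \<open>W\<close> is in general
    only a partial isometry.\<close>
  define s where "s j = (if d j = 0 then 0 else complex_of_real (1 / sqrt (d j)))" for j
  define W where "W = M * mat_diag m s"
  have M: "M \<in> carrier_mat n m" using R Vd unfolding M_def by simp
  have Mad: "mat_adjoint M \<in> carrier_mat m n" using M by (rule mat_adjoint_carrier)
  have G: "mat_adjoint M * M = mat_diag m (\<lambda>j. complex_of_real (d j))"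
    using gram_eq_mat_diag[OF M D[folded M_def]] unfolding d_def .
  have dnn: "0 \<le> d j" for j unfolding d_def by simp
  have W: "W \<in> carrier_mat n m" using M unfolding W_def by simp
  have Wad: "mat_adjoint W \<in> carrier_mat m n" using W by (rule mat_adjoint_carrier)
  have sds: "s j * (cnj (s j) * (complex_of_real (d j) * s j)) = s j" for j
  proof (cases "d j = 0")
    case False
    have "(1 / sqrt (d j)) * ((1 / sqrt (d j)) * (d j * (1 / sqrt (d j)))) = 1 / sqrt (d j)"
      using False dnn[of j] by (simp add: field_simps)
    hence "complex_of_real ((1 / sqrt (d j)) * ((1 / sqrt (d j)) * (d j * (1 / sqrt (d j)))))
        = complex_of_real (1 / sqrt (d j))" by (simp only:)
    thus ?thesis
      using False by (simp only: s_def if_False complex_cnj_complex_of_real of_real_mult)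
  qed (simp add: s_def)
  have "mat_adjoint W * W = mat_adjoint (mat_diag m s) * (mat_adjoint M * M * mat_diag m s)"
    unfolding W_def using M Mad
    by (simp add: mat_adjoint_mult[of M n m _ m] mat_adjoint_mat_diag
        assoc_mult_mat[of _ m m _ n _ m] assoc_mult_mat[of _ m n _ m _ m])
  hence WW: "mat_adjoint W * W = mat_diag m (\<lambda>j. cnj (s j) * (complex_of_real (d j) * s j))"
    unfolding G by (simp add: mat_adjoint_mat_diag)
  have "W * mat_adjoint W * W = W * (mat_adjoint W * W)"
    by (rule assoc_mult_mat[OF W Wad W])
  also have "\<dots> = M * (mat_diag m s * mat_diag m (\<lambda>j. cnj (s j) * (complex_of_real (d j) * s j)))"
    unfolding WW unfolding W_def using M by (intro assoc_mult_mat[of _ n m _ m _ m]) auto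
  also have "\<dots> = W" unfolding mat_diag_diag sds W_def ..
  finally have iso: "partial_isometry W" unfolding partial_isometry_def .
  \<comment> \<open>The Gram matrix of \<open>M\<close> is thus
    \<open>mat_adjoint V * (T * M)\<close>; multiplying by \<open>V\<close> shows that
    \<open>T\<close> maps column \<open>j\<close> of \<open>M\<close> to \<open>d j\<close> times
    column \<open>j\<close> of \<open>V\<close>.\<close>
  have "mat_adjoint M = mat_adjoint V * T"
    unfolding M_def using R Vd Rad by (simp add: mat_adjoint_mult[of R n m V m])
  hence "V * (mat_adjoint M * M) = V * (mat_adjoint V * (T * M))"
    using T M Vd by (simp add: assoc_mult_mat[of _ m m T n M m])
  also have "\<dots> = T * M"
    using T M Vd assoc_mult_mat[of V m m "mat_adjoint V" m "T * M" m, symmetric]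
      left_mult_one_mat[of "T * M" m m] by simp
  finally have TM: "T * M = V * mat_diag m (\<lambda>j. complex_of_real (d j))" unfolding G ..
  have "T * W = T * M * mat_diag m s"
    unfolding W_def using T M by (intro assoc_mult_mat[of _ m n _ m _ m, symmetric]) auto
  also have "\<dots> = V * mat_diag m (\<lambda>j. complex_of_real (d j) * s j)"
    unfolding TM using Vd(1) by (simp add: assoc_mult_mat[of V m m _ m _ m])
  finally have TW: "T * W = V * mat_diag m (\<lambda>j. complex_of_real (d j) * s j)" .
  \<comment> \<open>Column \<open>j\<close> of \<open>T * W\<close> is a unit vector times
    \<open>d j * s j\<close>, which is the square root of \<open>d j\<close>, also when
    \<open>d j = 0\<close>. Testing \<open>T\<close> on \<open>W\<close> therefore reproduces the
    sum that gives the norm of \<open>R\<close>.\<close>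
  have "col_sq (T * W) j = d j" if j: "j < m" for j
  proof -
    have "complex_of_real (col_sq V j) = 1"
      using gram_diagonal[of j V] j Vd(1) unfolding Vd(3) by simp
    hence "col_sq V j = 1" by simp
    moreover have "(cmod (complex_of_real (d j) * s j))\<^sup>2 = d j"
      using dnn[of j] by (simp add: s_def norm_mult norm_divide power_mult_distrib power_divide power2_eq_square)
    ultimately show ?thesis unfolding TW using j by (simp add: col_sq_mult_diag[OF Vd(1)])
  qed
  hence "col_powr_sum p (T * W) = col_powr_sum p M"
    using W M by (simp add: col_powr_sum_def d_def)
  hence "schatten_norm p R powr p \<le> schatten_norm p T powr p"
    using col_powr_sum_le_schatten_norm[OF p T W iso] norm unfolding M_def by simp
  thus ?thesis unfolding R_def by (rule le_if_powr_le) (use p in auto)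
qed

lemma schatten_norm_smult_le:
  assumes p: "2 \<le> p" and T: "T \<in> carrier_mat m n"
  shows "schatten_norm p (c \<cdot>\<^sub>m T) \<le> cmod c * schatten_norm p T"
proof -
  have cT: "c \<cdot>\<^sub>m T \<in> carrier_mat m n" using T by simp
  obtain V f where V: "unitary_mat n V"
    and norm: "schatten_norm p (c \<cdot>\<^sub>m T) powr p = col_powr_sum p (c \<cdot>\<^sub>m T * V)"
    using schatten_norm_attained[OF cT, of p] p by auto
  note Vd = unitary_matD[OF V]
  have "c \<cdot>\<^sub>m T * V = c \<cdot>\<^sub>m (T * V)" using T Vd by (simp add: mult_smult_assoc_mat[of _ m n _ n])
  moreover have "((cmod c)\<^sup>2) powr (p / 2) = cmod c powr p"
    by (simp add: powr_powr flip: powr_numeral)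
  ultimately have "schatten_norm p (c \<cdot>\<^sub>m T) powr p = cmod c powr p * col_powr_sum p (T * V)"
    unfolding norm col_powr_sum_def
    by (simp add: col_sq_smult powr_mult sum_distrib_left)
  also have "\<dots> \<le> cmod c powr p * schatten_norm p T powr p"
    using col_powr_sum_le_schatten_norm[OF p T Vd(1) partial_isometry_unitary[OF V]]
    by (intro mult_left_mono) auto
  also have "\<dots> = (cmod c * schatten_norm p T) powr p" by (simp add: powr_mult)
  finally show ?thesis by (rule le_if_powr_le) (use p in auto)
qed

text \<open>On an eigenbasis for \<open>S + T\<close> use the Euclidean triangle inequality in each
  column, then Minkowski's inequality over the columns. The variational bound controls the sums for
  \<open>S\<close> and \<open>T\<close> on that same basis.\<close>

lemma schatten_norm_triangle:
  assumes p: "2 \<le> p" and S: "S \<in> carrier_mat m n" and T: "T \<in> carrier_mat m n"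
  shows "schatten_norm p (S + T) \<le> schatten_norm p S + schatten_norm p T"
proof (rule field_le_epsilon)
  fix e :: real
  assume e: "0 < e"
  have ST: "S + T \<in> carrier_mat m n" using S T by simp
  obtain V f where V: "unitary_mat n V"
    and norm: "schatten_norm p (S + T) powr p = col_powr_sum p ((S + T) * V)"
    using schatten_norm_attained[OF ST, of p] p by auto
  note Vd = unitary_matD[OF V]
  \<comment> \<open>The slack \<open>e / 2\<close> makes both bounds strictly positive, as
    \<open>minkowski_powr\<close> requires, even if a norm is 0.\<close>
  define \<alpha> \<beta> where "\<alpha> = schatten_norm p S + e / 2" and "\<beta> = schatten_norm p T + e / 2"
  have pos: "0 < \<alpha>" "0 < \<beta>"
    using e schatten_norm_nonneg[of p S] schatten_norm_nonneg[of p T] unfolding \<alpha>_def \<beta>_def by linarith+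
  have sqrt_powr: "sqrt x powr p = x powr (p / 2)" if "0 \<le> x" for x
    using that by (simp add: powr_half_sqrt[symmetric] powr_powr)
  have bound: "(\<Sum>j<n. sqrt (col_sq (X * V) j) powr p) \<le> (schatten_norm p X + e / 2) powr p"
    if X: "X \<in> carrier_mat m n" for X
  proof -
    have "(\<Sum>j<n. sqrt (col_sq (X * V) j) powr p) = col_powr_sum p (X * V)"
      using X Vd by (simp add: col_powr_sum_def sqrt_powr)
    also have "\<dots> \<le> schatten_norm p X powr p"
      by (rule col_powr_sum_le_schatten_norm[OF p X Vd(1) partial_isometry_unitary[OF V]])
    also have "\<dots> \<le> (schatten_norm p X + e / 2) powr p"
      using e p by (intro powr_mono2) auto
    finally show ?thesis .
  qed
  have "schatten_norm p (S + T) powr p = (\<Sum>j<n. sqrt (col_sq (S * V + T * V) j) powr p)"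
    unfolding norm using S T Vd
    by (simp add: col_powr_sum_def sqrt_powr add_mult_distrib_mat[of _ m n _ _ n])
  also have "\<dots> \<le> (\<Sum>j<n. (sqrt (col_sq (S * V) j) + sqrt (col_sq (T * V) j)) powr p)"
    using S T Vd p by (intro sum_mono powr_mono2 sqrt_col_sq_add_le[of _ m n]) auto
  also have "\<dots> \<le> (\<alpha> + \<beta>) powr p"
    using p pos bound[OF S] bound[OF T] unfolding \<alpha>_def \<beta>_def
    by (intro minkowski_powr) auto
  finally have "schatten_norm p (S + T) \<le> \<alpha> + \<beta>"
    by (rule le_if_powr_le) (use p pos in auto)
  thus "schatten_norm p (S + T) \<le> schatten_norm p S + schatten_norm p T + e"
    unfolding \<alpha>_def \<beta>_def by simp
qed

section \<open>Block matrices\<close>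

lemma sum_lessThan_add:
  fixes f :: "nat \<Rightarrow> 'a::comm_monoid_add"
  shows "(\<Sum>i<m + n. f i) = (\<Sum>i<m. f i) + (\<Sum>i<n. f (m + i))"
  by (induction n) (simp_all add: add.assoc)

lemma col_powr_sum_four_block:
  assumes "A \<in> carrier_mat m1 n1" "B \<in> carrier_mat m1 n2"
    "C \<in> carrier_mat m2 n1" "D \<in> carrier_mat m2 n2"
  shows "col_powr_sum p (four_block_mat A B C D)
    = (\<Sum>j<n1. (col_sq A j + col_sq C j) powr (p / 2))
      + (\<Sum>j<n2. (col_sq B j + col_sq D j) powr (p / 2))"
proof -
  have "col_sq (four_block_mat A B C D) j = col_sq A j + col_sq C j" if "j < n1" for j
    using assms that by (simp add: col_sq_def sum_lessThan_add)
  moreover have "col_sq (four_block_mat A B C D) (n1 + j) = col_sq B j + col_sq D j" if "j < n2" for j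
    using assms that by (simp add: col_sq_def sum_lessThan_add)
  ultimately show ?thesis using assms by (simp add: col_powr_sum_def sum_lessThan_add)
qed

text \<open>A block diagonal unitary built from eigenbases for the two corners makes the columns of
  the product orthogonal, so the squared singular values of the corners are simply
  collected.\<close>

lemma schatten_norm_off_diagonal:
  assumes p: "2 \<le> p" and X: "X \<in> carrier_mat n n" and Y: "Y \<in> carrier_mat n n"
  shows "schatten_norm p (four_block_mat (0\<^sub>m n n) X Y (0\<^sub>m n n)) powr p
    = schatten_norm p X powr p + schatten_norm p Y powr p"
proof -
  obtain U f where U: "unitary_mat n U" and f: "mat_adjoint (X * U) * (X * U) = mat_diag n f"
    and nX: "schatten_norm p X powr p = col_powr_sum p (X * U)"
    using schatten_norm_attained[OF X, of p] p by auto
  obtain V g where V: "unitary_mat n V" and g: "mat_adjoint (Y * V) * (Y * V) = mat_diag n g"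
    and nY: "schatten_norm p Y powr p = col_powr_sum p (Y * V)"
    using schatten_norm_attained[OF Y, of p] p by auto
  define M where "M = four_block_mat (0\<^sub>m n n) X Y (0\<^sub>m n n)"
  \<comment> \<open>\<open>V\<close> comes first because \<open>Y\<close> occupies the first
    \<open>n\<close> columns.\<close>
  define W where "W = four_block_mat V (0\<^sub>m n n) (0\<^sub>m n n) U"
  have M: "M \<in> carrier_mat (n + n) (n + n)" unfolding M_def by simp
  have W: "unitary_mat (n + n) W" unfolding W_def using V U by (rule unitary_mat_four_block)
  have XU: "X * U \<in> carrier_mat n n" "mat_adjoint (X * U) \<in> carrier_mat n n"
    and YV: "Y * V \<in> carrier_mat n n" "mat_adjoint (Y * V) \<in> carrier_mat n n"
    using X Y unitary_matD[OF U] unitary_matD[OF V] by (auto intro!: mat_adjoint_carrier[of _ n n])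
  have MW: "M * W = four_block_mat (0\<^sub>m n n) (X * U) (Y * V) (0\<^sub>m n n)"
    unfolding M_def W_def using X Y unitary_matD(1)[OF U] unitary_matD(1)[OF V] XU(1) YV(1)
    by (simp add: mult_four_block_mat[of _ n n _ n _ n _ _ n _ n] left_mult_zero_mat[of _ n n]
        right_mult_zero_mat[of _ n n])
  have "mat_adjoint (M * W) * (M * W)
      = four_block_mat (mat_diag n g) (0\<^sub>m n n) (0\<^sub>m n n) (mat_diag n f)"
    unfolding MW using XU YV
    by (simp add: mat_adjoint_four_block[of _ n n _ n _ n] mult_four_block_mat[of _ n n _ n _ n _ _ n _ n]
        left_mult_zero_mat[of _ n n] right_mult_zero_mat[of _ n n] f g)
  also have "\<dots> = mat_diag (n + n) (\<lambda>i. if i < n then g i else f (i - n))"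
    by (intro eq_matI) (auto simp: mat_diag_def)
  finally have "schatten_norm p M = col_powr_sum p (M * W) powr (1 / p)"
    by (rule schatten_norm_eq_col_powr_sum[OF M W])
  hence "schatten_norm p M powr p = col_powr_sum p (M * W)" using p by (simp add: powr_powr)
  also have "\<dots> = col_powr_sum p (Y * V) + col_powr_sum p (X * U)"
  proof -
    have "col_sq (0\<^sub>m n n) j = 0" if "j < n" for j using that by (simp add: col_sq_def)
    thus ?thesis unfolding MW using XU YV unitary_matD(1)[OF U] unitary_matD(1)[OF V]
      by (simp add: col_powr_sum_four_block[of _ n n _ n _ n]) (simp add: col_powr_sum_def)
  qed
  finally show ?thesis unfolding M_def nX nY by simp
qed

text \<open>McCarthy's inequality \<open>tr (P ^ q) + tr (Q ^ q) \<le> tr ((P + Q) ^ q)\<close> for \<open>P = A\<^sup>* A\<close>,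
  \<open>Q = B\<^sup>* B\<close>, \<open>q = p / 2\<close>: pass from the stacked matrix with Gram matrix \<open>P + Q\<close> to its adjoint
  and test the latter on eigenbases of \<open>A A\<^sup>*\<close> and \<open>B B\<^sup>*\<close>.\<close>

lemma schatten_norm_superadditive:
  assumes p: "2 \<le> p" and A: "A \<in> carrier_mat n n" and B: "B \<in> carrier_mat n n"
  obtains V where "unitary_mat n V"
    "schatten_norm p A powr p + schatten_norm p B powr p
      \<le> (\<Sum>j<n. (col_sq (A * V) j + col_sq (B * V) j) powr (p / 2))"
proof -
  have Aad: "mat_adjoint A \<in> carrier_mat n n" and Bad: "mat_adjoint B \<in> carrier_mat n n"
    using A B by (auto intro: mat_adjoint_carrier)
  \<comment> \<open>The blocks without columns make this the matrix of size \<open>n + n\<close> by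
    \<open>n\<close> with \<open>A\<close> on top of \<open>B\<close>.\<close>
  define Z where "Z = four_block_mat A (0\<^sub>m n 0) B (0\<^sub>m n 0)"
  have Z: "Z \<in> carrier_mat (n + n) n"
    using four_block_carrier_mat[of A n n "0\<^sub>m n 0" n 0 "0\<^sub>m n 0" B] A unfolding Z_def by simp
  have Zad: "mat_adjoint Z = four_block_mat (mat_adjoint A) (mat_adjoint B) (0\<^sub>m 0 n) (0\<^sub>m 0 n)"
    unfolding Z_def using A B by (simp add: mat_adjoint_four_block[of _ n n _ 0 _ n])
  obtain U where U: "unitary_mat n U"
    and nA: "schatten_norm p (mat_adjoint A) powr p = col_powr_sum p (mat_adjoint A * U)"
    using schatten_norm_attained[OF Aad, of p] p by auto
  obtain U' where U': "unitary_mat n U'"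
    and nB: "schatten_norm p (mat_adjoint B) powr p = col_powr_sum p (mat_adjoint B * U')"
    using schatten_norm_attained[OF Bad, of p] p by auto
  define W where "W = four_block_mat U (0\<^sub>m n n) (0\<^sub>m n n) U'"
  have W: "unitary_mat (n + n) W" unfolding W_def using U U' by (rule unitary_mat_four_block)
  note Ud = unitary_matD(1)[OF U] unitary_matD(1)[OF U']
  have AU: "mat_adjoint A * U \<in> carrier_mat n n" "mat_adjoint B * U' \<in> carrier_mat n n"
    using Ud Aad Bad by auto
  have ZW: "mat_adjoint Z * W
      = four_block_mat (mat_adjoint A * U) (mat_adjoint B * U') (0\<^sub>m 0 n) (0\<^sub>m 0 n)"
    unfolding Zad W_def using Aad Bad Ud AU
    by (simp add: mult_four_block_mat[of _ n n _ n _ 0 _ _ n _ n] left_mult_zero_mat[of _ n n]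
        right_mult_zero_mat[of _ n n])
  have "col_sq (0\<^sub>m 0 n) j = 0" for j by (simp add: col_sq_def)
  hence "col_powr_sum p (mat_adjoint Z * W)
      = schatten_norm p (mat_adjoint A) powr p + schatten_norm p (mat_adjoint B) powr p"
    unfolding ZW nA nB using AU Ud
    by (simp add: col_powr_sum_four_block[of _ n n _ n _ 0]) (simp add: col_powr_sum_def)
  moreover have "schatten_norm p X powr p \<le> schatten_norm p (mat_adjoint X) powr p"
    if "X \<in> carrier_mat n n" for X
    using schatten_norm_adjoint_le[OF p mat_adjoint_carrier[OF that]] p
    by (intro powr_mono2) auto
  moreover have "col_powr_sum p (mat_adjoint Z * W) \<le> schatten_norm p (mat_adjoint Z) powr p"
    using mat_adjoint_carrier[OF Z] unitary_matD(1)[OF W] partial_isometry_unitary[OF W]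
    by (intro col_powr_sum_le_schatten_norm[OF p])
  moreover have "schatten_norm p (mat_adjoint Z) powr p \<le> schatten_norm p Z powr p"
    using schatten_norm_adjoint_le[OF p Z] p by (intro powr_mono2) auto
  ultimately have le: "schatten_norm p A powr p + schatten_norm p B powr p \<le> schatten_norm p Z powr p"
    using A B by (smt (verit))
  \<comment> \<open>An eigenbasis of the sum of the two Gram matrices. Keeping it explicit lets the
    two squared column norms be combined column by column afterwards.\<close>
  obtain V where V: "unitary_mat n V" and nZ: "schatten_norm p Z powr p = col_powr_sum p (Z * V)"
    using schatten_norm_attained[OF Z, of p] p by auto
  note Vd = unitary_matD(1)[OF V]
  have AV: "A * V \<in> carrier_mat n n" "B * V \<in> carrier_mat n n" using A B Vd by auto
  have "Z * V = four_block_mat (A * V) (0\<^sub>m n 0) (B * V) (0\<^sub>m n 0)"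
    unfolding Z_def using A B Vd AV by (intro eq_matI) (auto simp: scalar_prod_def)
  hence "col_powr_sum p (Z * V) = (\<Sum>j<n. (col_sq (A * V) j + col_sq (B * V) j) powr (p / 2))"
    using AV by (simp add: col_powr_sum_four_block[of _ n n _ 0 _ n])
  with le nZ V that show ?thesis by simp
qed

section \<open>The Schatten numerical radius\<close>

lemma re_mat_carrier: "T \<in> carrier_mat n n \<Longrightarrow> re_mat T \<in> carrier_mat n n"
  unfolding re_mat_def by (auto intro: mat_adjoint_carrier)

text \<open>The real part is the mean of \<open>T\<close> and its adjoint, and passing to the
  adjoint does not increase the norm.\<close>

lemma schatten_norm_re_mat_le:
  assumes p: "2 \<le> p" and T: "T \<in> carrier_mat n n"
  shows "schatten_norm p (re_mat T) \<le> schatten_norm p T"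
proof -
  have Tad: "mat_adjoint T \<in> carrier_mat n n" using T by (rule mat_adjoint_carrier)
  have "schatten_norm p (re_mat T) \<le> cmod (1 / 2) * schatten_norm p (T + mat_adjoint T)"
    unfolding re_mat_def using T Tad by (intro schatten_norm_smult_le[OF p, of _ n n]) auto
  also have "\<dots> \<le> 1 / 2 * (schatten_norm p T + schatten_norm p (mat_adjoint T))"
    using schatten_norm_triangle[OF p T Tad] by simp
  finally show ?thesis using schatten_norm_adjoint_le[OF p T] by simp
qed

text \<open>The point is that the set under the supremum is bounded:
  \<open>schatten_norm p T\<close> is an upper bound, since neither a unimodular factor nor
  \<open>re_mat\<close> increases the norm.\<close>

lemma schatten_norm_le_num_radius:
  assumes p: "2 \<le> p" and T: "T \<in> carrier_mat n n"
  shows "schatten_norm p (re_mat (cis \<theta> \<cdot>\<^sub>m T)) \<le> schatten_num_radius p T"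
  unfolding schatten_num_radius_def
proof (rule cSUP_upper)
  have "schatten_norm p (re_mat (cis \<phi> \<cdot>\<^sub>m T)) \<le> schatten_norm p T" for \<phi>
    using schatten_norm_re_mat_le[OF p, of "cis \<phi> \<cdot>\<^sub>m T" n] schatten_norm_smult_le[OF p T, of "cis \<phi>"] T
    by simp
  thus "bdd_above (range (\<lambda>\<theta>. schatten_norm p (re_mat (cis \<theta> \<cdot>\<^sub>m T))))"
    by (intro bdd_aboveI2)
qed simp

text \<open>Clarkson's inequality for the Cartesian decomposition \<open>T = H + \<i> K\<close>, whose two parts are
  \<open>Re T\<close> and \<open>Re (- \<i> T)\<close>.\<close>

lemma schatten_norm_le_num_radius_clarkson:
  assumes p: "2 \<le> p" and T: "T \<in> carrier_mat n n"
  shows "2 powr (1 / p) * (schatten_norm p T / 2) \<le> schatten_num_radius p T"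
proof -
  define w where "w = schatten_num_radius p T"
  define H where "H = re_mat (cis 0 \<cdot>\<^sub>m T)"
  define K where "K = re_mat (cis (- (pi / 2)) \<cdot>\<^sub>m T)"
  have Tad: "mat_adjoint T \<in> carrier_mat n n" using T by (rule mat_adjoint_carrier)
  have H: "H \<in> carrier_mat n n" and K: "K \<in> carrier_mat n n"
    unfolding H_def K_def using T by (auto intro!: re_mat_carrier)
  have cis: "cis (- (pi / 2)) = - \<i>" by (simp add: complex_eq_iff)
  have HK: "T = H + \<i> \<cdot>\<^sub>m K" "mat_adjoint T = H + (- \<i>) \<cdot>\<^sub>m K"
    unfolding H_def K_def re_mat_def cis using T
    by (auto intro!: eq_matI simp: field_simps)
  have le: "schatten_norm p H powr p \<le> w powr p" "schatten_norm p K powr p \<le> w powr p"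
    using p schatten_norm_le_num_radius[OF p T, of 0]
      schatten_norm_le_num_radius[OF p T, of "- (pi / 2)"]
    unfolding H_def[symmetric] K_def[symmetric] w_def[symmetric] by (auto intro!: powr_mono2)
  have w: "0 \<le> w"
    using schatten_norm_le_num_radius[OF p T, of 0] schatten_norm_nonneg[of p "re_mat (cis 0 \<cdot>\<^sub>m T)"]
    unfolding w_def by linarith
  \<comment> \<open>McCarthy's inequality for \<open>T\<close> and its adjoint yields one basis for
    both, so the parallelogram law applies in each column.\<close>
  obtain V where V: "unitary_mat n V"
    and sup: "schatten_norm p T powr p + schatten_norm p (mat_adjoint T) powr p
      \<le> (\<Sum>j<n. (col_sq (T * V) j + col_sq (mat_adjoint T * V) j) powr (p / 2))"
    using schatten_norm_superadditive[OF p T Tad] by blast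
  note Vd = unitary_matD(1)[OF V]
  have HV: "H * V \<in> carrier_mat n n" and KV: "K * V \<in> carrier_mat n n" using H K Vd by auto
  have TV: "T * V = H * V + \<i> \<cdot>\<^sub>m (K * V)" "mat_adjoint T * V = H * V + (- \<i>) \<cdot>\<^sub>m (K * V)"
    unfolding HK(2) using H K Vd
    by (subst HK(1), simp_all add: add_mult_distrib_mat[of _ n n _ _ n] mult_smult_assoc_mat[of K n n V n])
  \<comment> \<open>Midpoint convexity of the power \<open>p / 2\<close>. The constant is
    \<open>4 powr (p / 2) = 2 powr p\<close>, halved by the mean.\<close>
  have conv: "(2 * (a + b)) powr (p / 2) \<le> 2 powr (p - 1) * (a powr (p / 2) + b powr (p / 2))"
    if "0 \<le> a" "0 \<le> b" for a b :: real
  proof -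
    have "2 * ((a + b) / 2) powr (p / 2) \<le> a powr (p / 2) + b powr (p / 2)"
      using powr_perspective_le[of "p / 2" a b 1 1] p that by simp
    hence "2 powr (p - 1) * (2 * ((a + b) / 2) powr (p / 2))
        \<le> 2 powr (p - 1) * (a powr (p / 2) + b powr (p / 2))"
      by (intro mult_left_mono) auto
    also have "2 powr (p - 1) * (2 * ((a + b) / 2) powr (p / 2)) = 2 powr p * ((a + b) / 2) powr (p / 2)"
      by (simp add: powr_diff)
    also have "2 powr p = (4 :: real) powr (p / 2)"
      using powr_powr[of 2 2 "p / 2"] by simp
    also have "4 powr (p / 2) * ((a + b) / 2) powr (p / 2) = (2 * (a + b)) powr (p / 2)"
    proof -
      have "4 powr (p / 2) * ((a + b) / 2) powr (p / 2) = (4 * ((a + b) / 2)) powr (p / 2)"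
        by (rule powr_mult[symmetric])
      also have "4 * ((a + b) / 2) = 2 * (a + b)" by simp
      finally show ?thesis .
    qed
    finally show ?thesis .
  qed
  have "2 * schatten_norm p T powr p
      \<le> schatten_norm p T powr p + schatten_norm p (mat_adjoint T) powr p"
    using schatten_norm_adjoint_le[OF p Tad] powr_mono2[of p "schatten_norm p T"] p by simp
  also have "\<dots> \<le> (\<Sum>j<n. (2 * (col_sq (H * V) j + col_sq (K * V) j)) powr (p / 2))"
    using sup unfolding TV by (simp add: col_sq_parallelogram[OF HV KV] del: index_smult_mat)
  also have "\<dots> \<le> (\<Sum>j<n. 2 powr (p - 1) * (col_sq (H * V) j powr (p / 2) + col_sq (K * V) j powr (p / 2)))"
    by (intro sum_mono conv) auto
  also have "\<dots> = 2 powr (p - 1) * (col_powr_sum p (H * V) + col_powr_sum p (K * V))"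
    using Vd by (simp add: col_powr_sum_def sum.distrib flip: sum_distrib_left)
  also have "\<dots> \<le> 2 powr (p - 1) * (w powr p + w powr p)"
    using col_powr_sum_le_schatten_norm[OF p H Vd partial_isometry_unitary[OF V]]
      col_powr_sum_le_schatten_norm[OF p K Vd partial_isometry_unitary[OF V]] le
    by (intro mult_left_mono add_mono) auto
  finally have "schatten_norm p T powr p \<le> 2 powr (p - 1) * w powr p" by simp
  hence "2 * (schatten_norm p T / 2) powr p \<le> w powr p"
    by (simp add: powr_divide powr_diff field_simps)
  moreover have "(2 powr (1 / p) * (schatten_norm p T / 2)) powr p = 2 * (schatten_norm p T / 2) powr p"
    unfolding powr_mult using p by (simp add: powr_powr)
  ultimately have "(2 powr (1 / p) * (schatten_norm p T / 2)) powr p \<le> w powr p" by simp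
  thus ?thesis unfolding w_def[symmetric] by (rule le_if_powr_le) (use p w in auto)
qed

section \<open>The off-diagonal block matrix\<close>

lemma re_mat_off_diagonal:
  fixes \<theta> :: real
  assumes A: "A \<in> carrier_mat n n" and B: "B \<in> carrier_mat n n"
  defines "X \<equiv> (1 / 2) \<cdot>\<^sub>m (cis \<theta> \<cdot>\<^sub>m A + cis (- \<theta>) \<cdot>\<^sub>m mat_adjoint B)"
  shows "re_mat (cis \<theta> \<cdot>\<^sub>m four_block_mat (0\<^sub>m n n) A B (0\<^sub>m n n))
    = four_block_mat (0\<^sub>m n n) X (mat_adjoint X) (0\<^sub>m n n)"
  using A B unfolding X_def re_mat_def
  by (intro eq_matI) (auto simp: cis_cnj algebra_simps)

lemma schatten_norm_corner_le:
  fixes \<theta> :: real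
  assumes p: "2 \<le> p" and A: "A \<in> carrier_mat n n" and B: "B \<in> carrier_mat n n"
  defines "X \<equiv> (1 / 2) \<cdot>\<^sub>m (cis \<theta> \<cdot>\<^sub>m A + cis (- \<theta>) \<cdot>\<^sub>m mat_adjoint B)"
  shows "schatten_norm p X \<le> schatten_num_radius p A + schatten_norm p (A + B) / 2"
    and "schatten_norm p X \<le> schatten_num_radius p A + schatten_norm p (A - B) / 2"
proof -
  have ad: "mat_adjoint A \<in> carrier_mat n n" "mat_adjoint B \<in> carrier_mat n n"
    using A B by (auto intro: mat_adjoint_carrier)
  have rest: "schatten_norm p (c \<cdot>\<^sub>m mat_adjoint C) \<le> schatten_norm p C / 2"
    if "C \<in> carrier_mat n n" "cmod c = 1 / 2" for c C
    using schatten_norm_smult_le[OF p mat_adjoint_carrier[OF that(1)], of c] that(2)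
      schatten_norm_adjoint_le[OF p that(1)] by simp
  \<comment> \<open>Writing \<open>B\<close> as \<open>(A + B) - A\<close> leaves half the
    difference of \<open>cis \<theta>\<close> times \<open>A\<close> and its adjoint. This is
    skew-Hermitian, hence \<open>\<i>\<close> times a real part with the phase turned back by
    \<open>pi / 2\<close>.\<close>
  have "cis (\<theta> - pi / 2) = - \<i> * cis \<theta>"
    by (simp add: complex_eq_iff cos_diff sin_diff)
  hence "X = \<i> \<cdot>\<^sub>m re_mat (cis (\<theta> - pi / 2) \<cdot>\<^sub>m A) + (cis (- \<theta>) / 2) \<cdot>\<^sub>m mat_adjoint (A + B)"
    using A B unfolding X_def re_mat_def
    by (intro eq_matI) (auto simp: cis_cnj field_simps)
  moreover have "schatten_norm p (\<i> \<cdot>\<^sub>m re_mat (cis (\<theta> - pi / 2) \<cdot>\<^sub>m A)) \<le> schatten_num_radius p A"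
    using schatten_norm_smult_le[OF p re_mat_carrier, of "cis (\<theta> - pi / 2) \<cdot>\<^sub>m A" n \<i>] A
      schatten_norm_le_num_radius[OF p A, of "\<theta> - pi / 2"] by simp
  moreover have "schatten_norm p ((cis (- \<theta>) / 2) \<cdot>\<^sub>m mat_adjoint (A + B)) \<le> schatten_norm p (A + B) / 2"
    using A B by (intro rest) (auto simp: norm_divide)
  moreover have "schatten_norm p (\<i> \<cdot>\<^sub>m re_mat (cis (\<theta> - pi / 2) \<cdot>\<^sub>m A) + (cis (- \<theta>) / 2) \<cdot>\<^sub>m mat_adjoint (A + B))
      \<le> schatten_norm p (\<i> \<cdot>\<^sub>m re_mat (cis (\<theta> - pi / 2) \<cdot>\<^sub>m A)) + schatten_norm p ((cis (- \<theta>) / 2) \<cdot>\<^sub>m mat_adjoint (A + B))"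
    using A B by (intro schatten_norm_triangle[OF p, of _ n n])
      (auto simp: re_mat_carrier intro!: mat_adjoint_carrier)
  ultimately show "schatten_norm p X \<le> schatten_num_radius p A + schatten_norm p (A + B) / 2"
    by simp
  \<comment> \<open>Writing \<open>B\<close> as \<open>A - (A - B)\<close> leaves a real part
    without any turn of the phase.\<close>
  have "X = re_mat (cis \<theta> \<cdot>\<^sub>m A) + (- cis (- \<theta>) / 2) \<cdot>\<^sub>m mat_adjoint (A - B)"
    using A B unfolding X_def re_mat_def
    by (intro eq_matI) (auto simp: cis_cnj field_simps)
  moreover have "schatten_norm p ((- cis (- \<theta>) / 2) \<cdot>\<^sub>m mat_adjoint (A - B)) \<le> schatten_norm p (A - B) / 2"
    using A B by (intro rest) (auto simp: norm_divide)
  moreover have "schatten_norm p (re_mat (cis \<theta> \<cdot>\<^sub>m A) + (- cis (- \<theta>) / 2) \<cdot>\<^sub>m mat_adjoint (A - B))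
      \<le> schatten_norm p (re_mat (cis \<theta> \<cdot>\<^sub>m A)) + schatten_norm p ((- cis (- \<theta>) / 2) \<cdot>\<^sub>m mat_adjoint (A - B))"
    using A B by (intro schatten_norm_triangle[OF p, of _ n n])
      (auto simp: re_mat_carrier intro!: mat_adjoint_carrier)
  ultimately show "schatten_norm p X \<le> schatten_num_radius p A + schatten_norm p (A - B) / 2"
    using schatten_norm_le_num_radius[OF p A, of \<theta>] by simp
qed

theorem theorem3p4:
  fixes n :: nat and A B :: "complex mat" and p :: real
  assumes "1 \<le> n"
    and "A \<in> carrier_mat n n" and "B \<in> carrier_mat n n"
    and "2 \<le> p"
  shows "schatten_num_radius p (four_block_mat (0\<^sub>m n n) A B (0\<^sub>m n n))
    \<le> 2 powr (1 / p) * min (schatten_num_radius p A) (schatten_num_radius p B)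
      + min (schatten_num_radius p (A + B)) (schatten_num_radius p (A - B))"
proof -
  note A = assms(2) and B = assms(3) and p = assms(4)
  have AB: "A + B \<in> carrier_mat n n" "A - B \<in> carrier_mat n n" using A B by auto
  define w where "w = min (schatten_num_radius p A) (schatten_num_radius p B)"
  have bound: "schatten_norm p (re_mat (cis \<theta> \<cdot>\<^sub>m four_block_mat (0\<^sub>m n n) A B (0\<^sub>m n n)))
      \<le> 2 powr (1 / p) * w + min (schatten_num_radius p (A + B)) (schatten_num_radius p (A - B))" for \<theta>
  proof -
    define X where "X = (1 / 2) \<cdot>\<^sub>m (cis \<theta> \<cdot>\<^sub>m A + cis (- \<theta>) \<cdot>\<^sub>m mat_adjoint B)"
    define M where "M = re_mat (cis \<theta> \<cdot>\<^sub>m four_block_mat (0\<^sub>m n n) A B (0\<^sub>m n n))"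
    have X: "X \<in> carrier_mat n n" unfolding X_def using A B by (auto intro: mat_adjoint_carrier)
    have Xad: "mat_adjoint X \<in> carrier_mat n n" using X by (rule mat_adjoint_carrier)
    have M: "M = four_block_mat (0\<^sub>m n n) X (mat_adjoint X) (0\<^sub>m n n)"
      unfolding M_def X_def by (rule re_mat_off_diagonal[OF A B])
    have "schatten_norm p M powr p = schatten_norm p X powr p + schatten_norm p (mat_adjoint X) powr p"
      unfolding M by (rule schatten_norm_off_diagonal[OF p X Xad])
    \<comment> \<open>The two corners are adjoint to each other; their equal contributions produce
      the factor \<open>2 powr (1 / p)\<close>.\<close>
    also have "\<dots> \<le> 2 * schatten_norm p X powr p"
      using schatten_norm_adjoint_le[OF p X] powr_mono2[of p "schatten_norm p (mat_adjoint X)"] p by simp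
    also have "\<dots> = (2 powr (1 / p) * schatten_norm p X) powr p"
      using p by (simp add: powr_mult powr_powr)
    finally have MX: "schatten_norm p M \<le> 2 powr (1 / p) * schatten_norm p X"
      by (rule le_if_powr_le) (use p in auto)
    \<comment> \<open>The adjoint has the shape of \<open>X\<close> with \<open>A\<close> and
      \<open>B\<close> exchanged and the same angle, so the corner estimates also hold with
      \<open>B\<close> in the leading role.\<close>
    have "mat_adjoint X = (1 / 2) \<cdot>\<^sub>m (cis \<theta> \<cdot>\<^sub>m B + cis (- \<theta>) \<cdot>\<^sub>m mat_adjoint A)"
      unfolding X_def using A B by (intro eq_matI) (auto simp: cis_cnj algebra_simps)
    note corner = schatten_norm_corner_le[OF p B A, of \<theta>, folded this]
    have "schatten_norm p X \<le> schatten_norm p (mat_adjoint X)"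
      using schatten_norm_adjoint_le[OF p Xad] by simp
    with corner have "schatten_norm p X \<le> schatten_num_radius p B + schatten_norm p (B + A) / 2"
      and "schatten_norm p X \<le> schatten_num_radius p B + schatten_norm p (B - A) / 2" by linarith+
    moreover have "B + A = A + B" using A B by (rule comm_add_mat[symmetric])
    moreover have "B - A = (- 1) \<cdot>\<^sub>m (A - B)" using A B by (intro eq_matI) auto
    moreover have "schatten_norm p ((- 1) \<cdot>\<^sub>m (A - B)) \<le> schatten_norm p (A - B)"
      using schatten_norm_smult_le[OF p AB(2), of "- 1"] by simp
    ultimately have "schatten_norm p X \<le> w + schatten_norm p (A + B) / 2"
      and "schatten_norm p X \<le> w + schatten_norm p (A - B) / 2"
      using schatten_norm_corner_le[OF p A B, of \<theta>, folded X_def] unfolding w_def by auto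
    \<comment> \<open>After this multiplication the half norms of \<open>A + B\<close> and
      \<open>A - B\<close> carry exactly the factor that
      \<open>schatten_norm_le_num_radius_clarkson\<close> absorbs, so the second minimum gets
      coefficient 1.\<close>
    hence "2 powr (1 / p) * schatten_norm p X \<le> 2 powr (1 / p) * (w + schatten_norm p (A + B) / 2)"
      and "2 powr (1 / p) * schatten_norm p X \<le> 2 powr (1 / p) * (w + schatten_norm p (A - B) / 2)"
      by (auto intro: mult_left_mono)
    thus ?thesis
      using MX schatten_norm_le_num_radius_clarkson[OF p AB(1)]
        schatten_norm_le_num_radius_clarkson[OF p AB(2)]
      unfolding M_def[symmetric] distrib_left by simp
  qed
  \<comment> \<open>The bound does not depend on \<open>\<theta>\<close>, so it passes to the
    supremum; only the radius of the block matrix is unfolded.\<close>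
  show ?thesis
    unfolding schatten_num_radius_def[of p "four_block_mat (0\<^sub>m n n) A B (0\<^sub>m n n)"]
    using bound unfolding w_def by (intro cSUP_least) auto
qed

end
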